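(* Let $\mathcal{P}$ be a finite patchwork on a set $\Omega$, and $B\in\mathcal{P}$ an autonomous set. Then exactly one of the following holds: (i) the cohort under $B$ has at least $3$ members, every two members of that cohort are adjacent, and the union of the cohort is all of $B$; (ii) the cohort under $B$ has at least $2$ members, the adjacency graph of that cohort is a path (i.e., consists of elements $A_1,\dots,A_n$ for some $n\geq 2$, with $A_i$ and $A_j$ adjacent iff $|i-j|=1$), and the union of the cohort is all of $B$; (iii) no two members of the cohort under $B$ are adjacent.
   Context: Subsets $A,B\subseteq\Omega$ overlap if $A\cap B\neq\emptyset$ but neither contains the other. A patchwork on $\Omega$ is a set $\mathcal{P}$ of subsets of $\Omega$ such that $\emptyset,\Omega\in\mathcal{P}$ and for every pair of overlapping $A,B\in\mathcal{P}$, the sets $A\cap B$, $A\cup B$, $A\setminus B$ belong to $\mathcal{P}$. Members of $\mathcal{P}$ are called $\mathcal{P}$-sets. A $\mathcal{P}$-set is autonomous if it is nonempty and does not overlap any member of $\mathcal{P}$. If $B$ is autonomous, the cohort under $B$ is the set of maximal autonomous proper subsets of $B$. Two $\mathcal{P}$-sets are adjacent if they are disjoint and their union is a $\mathcal{P}$-set. The adjacency graph of a family of $\mathcal{P}$-sets has the members as vertices, with an edge between two iff they are adjacent. *)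

theory Defs
  imports Main
begin

definition overlap :: "'a set \<Rightarrow> 'a set \<Rightarrow> bool" where
  "overlap A B \<longleftrightarrow> A \<inter> B \<noteq> {} \<and> \<not> A \<subseteq> B \<and> \<not> B \<subseteq> A"

definition patchwork :: "'a set \<Rightarrow> 'a set set \<Rightarrow> bool" where
  "patchwork \<Omega> P \<longleftrightarrow> P \<subseteq> Pow \<Omega> \<and> {} \<in> P \<and> \<Omega> \<in> P \<and>
     (\<forall>A\<in>P. \<forall>B\<in>P. overlap A B \<longrightarrow> A \<inter> B \<in> P \<and> A \<union> B \<in> P \<and> A - B \<in> P)"

definition autonomous :: "'a set set \<Rightarrow> 'a set \<Rightarrow> bool" where
  "autonomous P A \<longleftrightarrow> A \<in> P \<and> A \<noteq> {} \<and> (\<forall>B\<in>P. \<not> overlap A B)"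

definition cohort :: "'a set set \<Rightarrow> 'a set \<Rightarrow> 'a set set" where
  "cohort P B = {A. autonomous P A \<and> A \<subset> B \<and>
     \<not> (\<exists>C. autonomous P C \<and> C \<subset> B \<and> A \<subset> C)}"

definition adjacent :: "'a set set \<Rightarrow> 'a set \<Rightarrow> 'a set \<Rightarrow> bool" where
  "adjacent P A B \<longleftrightarrow> A \<in> P \<and> B \<in> P \<and> A \<inter> B = {} \<and> A \<union> B \<in> P"

text \<open>A simple graph is a pair of a vertex set and a set of two-element edges.\<close>

definition adjacency_graph :: "'a set set \<Rightarrow> 'a set set \<Rightarrow> 'a set set \<times> 'a set set set" where
  "adjacency_graph P F = (F, {{X, Y} | X Y. X \<in> F \<and> Y \<in> F \<and> X \<noteq> Y \<and> adjacent P X Y})"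

definition path_graph :: "'v set \<times> 'v set set \<Rightarrow> bool" where
  "path_graph G \<longleftrightarrow> (\<exists>vs. length vs \<ge> 2 \<and> distinct vs \<and> set vs = fst G \<and>
     (\<forall>i < length vs. \<forall>j < length vs.
        {vs ! i, vs ! j} \<in> snd G \<longleftrightarrow> \<bar>int i - int j\<bar> = 1))"

definition exactly_one_of :: "bool \<Rightarrow> bool \<Rightarrow> bool \<Rightarrow> bool" where
  "exactly_one_of p q r \<longleftrightarrow>
     (p \<and> \<not> q \<and> \<not> r) \<or> (\<not> p \<and> q \<and> \<not> r) \<or> (\<not> p \<and> \<not> q \<and> r)"

end

theory Submission
  imports Defs
begin

text \<open>
  For any point \<open>b\<close>, the least \<open>P\<close>-set containing \<open>b\<close> is autonomous. Hence a point of \<open>B\<close> outside the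
  cohort lies in no \<open>P\<close>-set strictly inside \<open>B\<close>. If two cohort members are adjacent, a maximal
  proper \<open>P\<close>-subset of \<open>B\<close> above their union together with a set overlapping it covers \<open>B\<close>, so the
  cohort partitions \<open>B\<close>. The \<open>P\<close>-sets that are unions of cohort members then form a patchwork on
  the cohort whose only autonomous sets are the singletons and the whole ground set.

  In such a primitive patchwork every path with at least two vertices has an edge leaving it, and
  the neighbours of a vertex of degree at least three are pairwise adjacent. So a longest path is
  Hamiltonian, as a vertex hanging off the interior could be inserted into it. A chord of this path
  closes a cycle; complementary arcs of the cycle meet in arbitrary pairs, so the cycle is a
  clique, and a chord of maximal length joins the two ends of the path.
\<close>

section \<open>Patchworks\<close>

text \<open>Sets that do not overlap are disjoint or nested, so overlap can be weakened in the
  closure axioms: intersections need no condition, unions only a common point, and differences only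
  that the subtrahend is not contained in the other set.\<close>

lemma patchwork_Int:
  assumes "patchwork \<Omega> P" "A \<in> P" "B \<in> P"
  shows "A \<inter> B \<in> P"
proof (cases "overlap A B")
  case True
  then show ?thesis using assms unfolding patchwork_def by blast
next
  case False
  then have "A \<inter> B = {} \<or> A \<inter> B = A \<or> A \<inter> B = B" unfolding overlap_def by blast
  then show ?thesis using assms unfolding patchwork_def by metis
qed

lemma patchwork_Un:
  assumes "patchwork \<Omega> P" "A \<in> P" "B \<in> P" "A \<inter> B \<noteq> {}"
  shows "A \<union> B \<in> P"
proof (cases "overlap A B")
  case True
  then show ?thesis using assms unfolding patchwork_def by blast
next
  case False
  then have "A \<union> B = A \<or> A \<union> B = B" using assms(4) unfolding overlap_def by blast
  then show ?thesis using assms by metis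
qed

lemma patchwork_Diff:
  assumes "patchwork \<Omega> P" "A \<in> P" "B \<in> P" "\<not> B \<subseteq> A"
  shows "A - B \<in> P"
proof (cases "overlap A B")
  case True
  then show ?thesis using assms unfolding patchwork_def by blast
next
  case False
  then have "A - B = A \<or> A - B = {}" using assms(4) unfolding overlap_def by blast
  then show ?thesis using assms unfolding patchwork_def by metis
qed

section \<open>Primitive patchworks\<close>

locale primitive_patchwork =
  fixes V :: "'v set" and Q :: "'v set set"
  assumes patchwork: "patchwork V Q"
    and finite_ground: "finite V"
    and singleton_mem: "v \<in> V \<Longrightarrow> {v} \<in> Q"
    and autonomous_trivial: "autonomous Q S \<Longrightarrow> S = V \<or> (\<exists>v. S = {v})"
begin

lemmas Int_mem = patchwork_Int[OF patchwork]
  and Un_mem = patchwork_Un[OF patchwork]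
  and Diff_mem = patchwork_Diff[OF patchwork]

lemma subset_ground: "S \<in> Q \<Longrightarrow> S \<subseteq> V"
  using patchwork unfolding patchwork_def by blast

lemma overlapping_mem:
  assumes "S \<in> Q" "S \<noteq> V" "a \<in> S" "b \<in> S" "a \<noteq> b"
  obtains C where "C \<in> Q" "overlap S C"
  using assms autonomous_trivial[of S] unfolding autonomous_def by fastforce

text \<open>
  A minimal set \<open>C\<close> overlapping \<open>K\<close> meets \<open>K\<close> in one vertex \<open>a\<close>, since otherwise an edge of \<open>K\<close> across
  the boundary of \<open>C\<close> allows \<open>a\<close> to be removed from \<open>C\<close>. A set overlapping \<open>C - {a}\<close> would shrink \<open>C\<close>
  further, so \<open>C - {a}\<close> is a singleton.
\<close>

lemma edge_leaving:
  assumes K: "K \<in> Q" "K \<noteq> V" "k \<in> K" "k' \<in> K" "k \<noteq> k'"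
    and conn: "\<And>C. C \<inter> K \<noteq> {} \<Longrightarrow> \<not> K \<subseteq> C \<Longrightarrow>
      \<exists>a b. a \<in> C \<and> a \<in> K \<and> b \<notin> C \<and> b \<in> K \<and> {a, b} \<in> Q"
  obtains a w where "a \<in> K" "w \<notin> K" "{a, w} \<in> Q"
proof -
  let ?\<C> = "{C \<in> Q. overlap K C}"
  have "finite Q"
    using subset_ground finite_ground by (meson PowI finite_Pow_iff finite_subset subsetI)
  moreover have "?\<C> \<noteq> {}" using overlapping_mem[OF K] by blast
  ultimately obtain C where "C \<in> ?\<C>" and "\<forall>D\<in>?\<C>. D \<subseteq> C \<longrightarrow> C = D"
    using finite_has_minimal[of ?\<C>] by auto
  then have C: "C \<in> Q" "overlap K C"
    and min: "\<And>D. D \<in> Q \<Longrightarrow> overlap K D \<Longrightarrow> D \<subseteq> C \<Longrightarrow> D = C" by blast+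
  obtain a b where ab: "a \<in> C" "a \<in> K" "b \<notin> C" "b \<in> K" "{a, b} \<in> Q"
    using conn[of C] C(2) unfolding overlap_def by blast
  have "C - {a, b} = C - {a}" using ab(3) by blast
  then have E: "C - {a} \<in> Q" using Diff_mem[OF C(1) ab(5)] ab(3) by simp
  have "C \<inter> K = {a}"
  proof (rule ccontr)
    assume "C \<inter> K \<noteq> {a}"
    then have "overlap K (C - {a})" using C(2) ab unfolding overlap_def by blast
    then show False using min[OF E] ab(1) by blast
  qed
  \<comment> \<open>\<open>b\<close> is a point of \<open>K\<close> outside \<open>C\<close>, and
    \<open>x\<close> lies outside \<open>K\<close> because \<open>C\<close> meets \<open>K\<close>
    only in \<open>a\<close>.\<close>
  then have ovl: "overlap K D" if "a \<in> D" "x \<in> D" "x \<noteq> a" "D \<subseteq> C" for D x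
    using that ab unfolding overlap_def by blast
  obtain w where w: "w \<in> C" "w \<notin> K" using C(2) unfolding overlap_def by blast
  have "C - {a} = {w}"
  proof (rule ccontr)
    assume "C - {a} \<noteq> {w}"
    then obtain w' where w': "w' \<in> C - {a}" "w' \<noteq> w" using w ab(2) by blast
    have "C - {a} \<noteq> V" using subset_ground[OF C(1)] ab(1) by blast
    then obtain F where F: "F \<in> Q" "overlap (C - {a}) F"
      using overlapping_mem[OF E _ w'(1), of w] w ab(2) w'(2) by blast
    \<comment> \<open>Whichever of \<open>C \<inter> F\<close> and \<open>C - F\<close> contains
      \<open>a\<close> also keeps another point of \<open>C\<close>. So it overlaps
      \<open>K\<close>, and being properly smaller than \<open>C\<close> it contradicts
      minimality.\<close>
    show False
    proof (cases "a \<in> F")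
      case True
      obtain x where "x \<in> C \<inter> F" "x \<noteq> a" using F(2) unfolding overlap_def by blast
      then have "overlap K (C \<inter> F)" using ovl[of "C \<inter> F" x] True ab(1) by blast
      then have "C \<inter> F = C" using min Int_mem[OF C(1) F(1)] by blast
      then show False using F(2) unfolding overlap_def by blast
    next
      case False
      then have "\<not> F \<subseteq> C" using F(2) unfolding overlap_def by blast
      then have "C - F \<in> Q" using Diff_mem C(1) F(1) by blast
      moreover obtain x where "x \<in> C - F" "x \<noteq> a" using F(2) unfolding overlap_def by blast
      then have "overlap K (C - F)" using ovl[of "C - F" x] False ab(1) by blast
      ultimately have "C - F = C" using min by blast
      then show False using F(2) unfolding overlap_def by blast
    qed
  qed
  then have "C = {a, w}" using ab(1) by blast
  then show ?thesis using that ab(2) w(2) C(1) by blast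
qed

text \<open>The path from \<open>y\<close> over \<open>x\<close> to \<open>z\<close> is a member.
  Subtracting the edge from \<open>x\<close> to \<open>w\<close> removes only \<open>x\<close>, and
  \<open>w\<close> lying off the path is what permits the difference.\<close>

lemma neighbours_adjacent:
  assumes "{x, y} \<in> Q" "{x, z} \<in> Q" "{x, w} \<in> Q" "distinct [x, y, z, w]"
  shows "{y, z} \<in> Q"
proof -
  have "{x, y} \<union> {x, z} \<in> Q" using assms Un_mem by blast
  then have "{x, y} \<union> {x, z} - {x, w} \<in> Q" using assms(3,4) by (intro Diff_mem) auto
  moreover have "{x, y} \<union> {x, z} - {x, w} = {y, z}" using assms(4) by auto
  ultimately show ?thesis by simp
qed

text \<open>Loops are included: \<open>edge x x\<close> holds at every vertex, since singletons are
  members. Distinctness is therefore always asked for separately.\<close>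

abbreviation edge :: "'v \<Rightarrow> 'v \<Rightarrow> bool" where
  "edge x y \<equiv> {x, y} \<in> Q"

section \<open>Walks and Hamiltonian paths\<close>

lemma walk_set_mem:
  assumes "successively edge vs" "set vs \<subseteq> V" "vs \<noteq> []"
  shows "set vs \<in> Q"
  using assms
proof (induction vs rule: induct_list012)
  case (3 x y zs)
  then have "{x, y} \<union> set (y # zs) \<in> Q" by (intro Un_mem) auto
  moreover have "{x, y} \<union> set (y # zs) = set (x # y # zs)" by auto
  ultimately show ?case by simp
qed (auto intro: singleton_mem)

text \<open>Supplies the connectivity hypothesis of \<open>edge_leaving\<close> for the vertex set
  of a walk.\<close>

lemma walk_crossing_edge:
  assumes "successively edge vs" "C \<inter> set vs \<noteq> {}" "\<not> set vs \<subseteq> C"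
  shows "\<exists>a b. a \<in> C \<and> a \<in> set vs \<and> b \<notin> C \<and> b \<in> set vs \<and> edge a b"
  using assms
proof (induction vs rule: induct_list012)
  case (3 x y zs)
  show ?case
  proof (cases "C \<inter> set (y # zs) \<noteq> {} \<and> \<not> set (y # zs) \<subseteq> C")
    case True
    then show ?thesis using 3 by (metis list.set_intros(2) successively.simps(3))
  next
    case False
    then have "(x \<in> C) \<noteq> (y \<in> C)" using "3.prems" by auto
    moreover have "edge x y" "edge y x" using "3.prems"(1) by (auto simp: insert_commute)
    ultimately show ?thesis by (meson list.set_intros)
  qed
qed auto

lemma longer_path:
  assumes vs: "successively edge vs" "distinct vs" "set vs \<subseteq> V" "2 \<le> length vs"
    and "set vs \<noteq> V"
  obtains ws where "successively edge ws" "distinct ws" "set ws \<subseteq> V" "length vs < length ws"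
proof -
  obtain k k' r where split: "vs = k # k' # r"
    using vs(4) by (metis One_nat_def Suc_1 Suc_le_length_iff)
  have "set vs \<in> Q" using walk_set_mem[OF vs(1,3)] split by blast
  then obtain x w where xw: "x \<in> set vs" "w \<notin> set vs" "edge x w"
    using edge_leaving[of "set vs" k k'] walk_crossing_edge[OF vs(1)] assms(5) vs(2) split
    by (metis distinct_length_2_or_more list.set_intros)
  have wV: "w \<in> V" using xw(3) subset_ground by blast
  have wx: "edge w x" using xw(3) by (simp add: insert_commute)
  obtain us zs where usx: "vs = us @ x # zs" using xw(1) by (meson split_list)
  consider "us = []" | "zs = []" | p us' n zs' where "us = us' @ [p]" "zs = n # zs'"
    by (metis neq_Nil_conv rev_exhaust)
  then show ?thesis
  proof cases
    case 1
    then show ?thesis using that[of "w # vs"] vs xw wV wx usx by (auto simp: successively_Cons)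
  next
    case 2
    then show ?thesis
      using that[of "vs @ [w]"] vs xw wV usx by (auto simp: successively_append_iff)
  next
    case 3
    have "edge x n" "edge p x" using vs(1) usx 3 by (auto simp: successively_append_iff)
    \<comment> \<open>\<open>w\<close>, \<open>n\<close> and \<open>p\<close> are three distinct
      neighbours of \<open>x\<close>, so \<open>w\<close> fits into the path between
      \<open>x\<close> and \<open>n\<close>.\<close>
    then have "edge w n"
      using neighbours_adjacent[of x w n p] xw vs(2) usx 3 by (auto simp: insert_commute)
    then show ?thesis
      using that[of "us @ x # w # zs"] vs xw wV usx 3
      by (auto simp: successively_append_iff successively_Cons)
  qed
qed

lemma hamiltonian_path:
  assumes "edge x y" "x \<noteq> y"
  obtains vs where "successively edge vs" "distinct vs" "set vs = V" "2 \<le> length vs"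
proof -
  define path where
    "path vs \<longleftrightarrow> successively edge vs \<and> distinct vs \<and> set vs \<subseteq> V \<and> 2 \<le> length vs" for vs
  have "path [x, y]" using assms subset_ground unfolding path_def by force
  moreover have "\<forall>vs. path vs \<longrightarrow> length vs < Suc (card V)"
    unfolding path_def by (metis card_mono distinct_card finite_ground le_imp_less_Suc)
  ultimately obtain vs where vs: "path vs" "\<forall>ws. path ws \<longrightarrow> length ws \<le> length vs"
    using ex_has_greatest_nat[of path "[x, y]" length] by blast
  have "set vs = V"
  proof (rule ccontr)
    assume "set vs \<noteq> V"
    then obtain ws where ws: "successively edge ws" "distinct ws" "set ws \<subseteq> V"
        "length vs < length ws"
      using longer_path vs(1) unfolding path_def by metis
    then have "path ws" using vs(1) unfolding path_def by simp
    then show False using vs(2) ws(4) by fastforce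
  qed
  then show ?thesis using that vs(1) unfolding path_def by blast
qed

section \<open>Chords of a path\<close>

lemma path_segment_mem:
  assumes "successively edge vs" "set vs \<subseteq> V" "i \<le> j" "j < length vs"
  shows "(!) vs ` {i..j} \<in> Q"
  using assms(3,4)
proof (induction j rule: dec_induct)
  case base
  then have "vs ! i \<in> V" using assms(2) nth_mem by blast
  then show ?case using singleton_mem by simp
next
  case (step j)
  have "edge (vs ! j) (vs ! Suc j)" using assms(1) step.prems by (simp add: successively_conv_nth)
  then have "(!) vs ` {i..j} \<union> {vs ! j, vs ! Suc j} \<in> Q"
    using step by (intro Un_mem) auto
  moreover have "(!) vs ` {i..j} \<union> {vs ! j, vs ! Suc j} = (!) vs ` {i..Suc j}"
    using step.hyps by (auto simp: atLeastAtMostSuc_conv)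
  ultimately show ?case by simp
qed

text \<open>The chord closes the segment from \<open>i\<close> to \<open>j\<close> into a cycle. The
  arc from \<open>p\<close> to \<open>q\<close> along the path and the complementary arc through the
  chord are both members, and they meet in exactly the two end vertices.\<close>

lemma chord_clique:
  assumes vs: "successively edge vs" "distinct vs" "set vs \<subseteq> V"
    and chord: "edge (vs ! i) (vs ! j)" "j < length vs"
    and pq: "i \<le> p" "p < q" "q \<le> j"
  shows "edge (vs ! p) (vs ! q)"
proof -
  let ?seg = "\<lambda>i j. (!) vs ` {i..j}"
  have "?seg i p \<union> {vs ! i, vs ! j} \<in> Q"
    using chord pq by (intro Un_mem path_segment_mem vs) auto
  then have "?seg i p \<union> {vs ! i, vs ! j} \<union> ?seg q j \<in> Q"
    using chord pq by (intro Un_mem path_segment_mem vs) auto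
  moreover have "?seg i p \<union> {vs ! i, vs ! j} \<union> ?seg q j = (!) vs ` ({i..p} \<union> {q..j})"
    using pq by auto
  ultimately have "(!) vs ` ({i..p} \<union> {q..j}) \<inter> ?seg p q \<in> Q"
    using chord pq by (intro Int_mem path_segment_mem vs) auto
  \<comment> \<open>Distinctness of the path allows the two arcs to be intersected on
    indices.\<close>
  moreover have "inj_on ((!) vs) {..<length vs}" using vs(2) by (simp add: inj_on_nth)
  then have "(!) vs ` ({i..p} \<union> {q..j}) \<inter> ?seg p q = (!) vs ` (({i..p} \<union> {q..j}) \<inter> {p..q})"
    using chord pq by (intro inj_on_image_Int[symmetric]) auto
  moreover have "({i..p} \<union> {q..j}) \<inter> {p..q} = {p, q}" using pq by auto
  ultimately show ?thesis by simp
qed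

lemma chord_imp_complete:
  assumes vs: "successively edge vs" "distinct vs" "set vs = V"
    and chord: "edge (vs ! i) (vs ! j)" "j < length vs" "i + 2 \<le> j"
    and xy: "x \<in> V" "y \<in> V"
  shows "edge x y"
proof -
  define ch where
    "ch = (\<lambda>(i, j). edge (vs ! i) (vs ! j) \<and> j < length vs \<and> i + 2 \<le> j)"
  have "ch (i, j)" using chord by (simp add: ch_def)
  moreover have "\<forall>e. ch e \<longrightarrow> snd e - fst e < length vs" by (auto simp: ch_def)
  ultimately obtain e where "ch e" "\<forall>e'. ch e' \<longrightarrow> snd e' - fst e' \<le> snd e - fst e"
    using ex_has_greatest_nat[of ch "(i, j)" "\<lambda>e. snd e - fst e"] by blast
  then obtain a b where ab: "ch (a, b)" and max: "\<And>c d. ch (c, d) \<Longrightarrow> d - c \<le> b - a"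
    by (cases e) force
  have ab': "edge (vs ! a) (vs ! b)" "b < length vs" "a + 2 \<le> b" using ab by (auto simp: ch_def)
  have consec: "edge (vs ! m) (vs ! Suc m)" if "Suc m < length vs" for m
    using vs(1) that by (simp add: successively_conv_nth)
  have "Suc b = length vs"
  proof (rule ccontr)
    assume "Suc b \<noteq> length vs"
    then have b: "Suc b < length vs" using ab'(2) by simp
    obtain b' where b': "b = Suc b'" using ab'(3) by (cases b) auto
    \<comment> \<open>If the path goes on past \<open>b\<close>, then \<open>a\<close>,
      \<open>b'\<close> and \<open>Suc b\<close> index three neighbours of the vertex at
      \<open>b\<close>, where \<open>a + 2 \<le> b\<close> keeps \<open>a\<close> and
      \<open>b'\<close> apart. This yields the longer chord from \<open>a\<close> to
      \<open>Suc b\<close>.\<close>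
    have "edge (vs ! b) (vs ! b')" "edge (vs ! b) (vs ! a)"
      using consec[of b'] ab' b' by (auto simp: insert_commute)
    then have "edge (vs ! a) (vs ! Suc b)"
      using neighbours_adjacent[of "vs ! b" "vs ! a" "vs ! Suc b" "vs ! b'"] consec[OF b] ab' b b'
        vs(2)
      by (simp add: nth_eq_iff_index_eq)
    then show False using max[of a "Suc b"] b ab'(3) by (simp add: ch_def)
  qed
  moreover have "a = 0"
  proof (rule ccontr)
    assume "a \<noteq> 0"
    then obtain a' where a: "a = Suc a'" by (cases a) auto
    \<comment> \<open>The mirror image: the vertex at \<open>a\<close> has neighbours at
      \<open>a'\<close>, \<open>b\<close> and \<open>Suc a\<close>, so the chord extends to
      \<open>a'\<close>.\<close>
    have "edge (vs ! a) (vs ! a')" "edge (vs ! a) (vs ! Suc a)"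
      using consec[of a'] consec[of a] ab' a by (auto simp: insert_commute)
    then have "edge (vs ! a') (vs ! b)"
      using neighbours_adjacent[of "vs ! a" "vs ! a'" "vs ! b" "vs ! Suc a"] ab' a vs(2)
      by (simp add: nth_eq_iff_index_eq)
    then show False using max[of a' b] ab' a by (simp add: ch_def)
  qed
  ultimately have ends: "edge (vs ! 0) (vs ! b)" "b < length vs" "length vs = Suc b"
    using ab' by auto
  obtain p q where pq: "x = vs ! p" "y = vs ! q" "p < length vs" "q < length vs"
    using xy vs(3) by (metis in_set_conv_nth)
  consider "p = q" | "p < q" | "q < p" by linarith
  then show ?thesis
  proof cases
    case 1
    then show ?thesis using pq xy singleton_mem by simp
  next
    case 2
    then show ?thesis using chord_clique[OF vs(1,2) _ ends(1,2), of p q] vs(3) pq ends(3) by simp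
  next
    case 3
    then show ?thesis
      using chord_clique[OF vs(1,2) _ ends(1,2), of q p] vs(3) pq ends(3)
      by (simp add: insert_commute)
  qed
qed

end

section \<open>Cohorts\<close>

context
  fixes \<Omega> :: "'a set" and P :: "'a set set" and B :: "'a set"
  assumes patch: "patchwork \<Omega> P" and fin: "finite P" and auto_B: "autonomous P B"
begin

lemma autonomous_cases:
  assumes "autonomous P A" "C \<in> P" "A \<inter> C \<noteq> {}"
  shows "A \<subseteq> C \<or> C \<subseteq> A"
  using assms unfolding autonomous_def overlap_def by blast

lemma cohort_mem:
  assumes "A \<in> cohort P B"
  shows "autonomous P A" "A \<in> P" "A \<noteq> {}" "A \<subset> B"
  using assms unfolding cohort_def autonomous_def by auto

lemma cohort_disjoint:
  assumes "X \<in> cohort P B" "Y \<in> cohort P B" "X \<noteq> Y"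
  shows "X \<inter> Y = {}"
proof (rule ccontr)
  assume "X \<inter> Y \<noteq> {}"
  then have "X \<subset> Y \<or> Y \<subset> X"
    using autonomous_cases[of X Y] cohort_mem assms by blast
  then show False using assms unfolding cohort_def by blast
qed

lemma finite_cohort: "finite (cohort P B)"
  by (rule finite_subset[OF _ fin]) (auto dest: cohort_mem)

text \<open>A minimal P-set around \<open>b\<close> is least because P-sets are closed under
  intersection. A P-set overlapping it would have to miss \<open>b\<close>, and subtracting it would
  leave a smaller P-set around \<open>b\<close>.\<close>

lemma autonomous_least_mem:
  assumes "b \<in> B"
  obtains D where "autonomous P D" "b \<in> D" "\<And>C. C \<in> P \<Longrightarrow> b \<in> C \<Longrightarrow> D \<subseteq> C"
proof -
  have "{D \<in> P. b \<in> D} \<noteq> {}" using auto_B assms unfolding autonomous_def by blast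
  then obtain D where "D \<in> {D \<in> P. b \<in> D}" "\<forall>C\<in>{D \<in> P. b \<in> D}. C \<subseteq> D \<longrightarrow> D = C"
    using finite_has_minimal[of "{D \<in> P. b \<in> D}"] fin by auto
  then have D: "D \<in> P" "b \<in> D"
    and min: "\<And>C. C \<in> P \<Longrightarrow> b \<in> C \<Longrightarrow> C \<subseteq> D \<Longrightarrow> C = D" by blast+
  have least: "D \<subseteq> C" if "C \<in> P" "b \<in> C" for C
    using min[OF patchwork_Int[OF patch D(1) that(1)]] D(2) that(2) by blast
  have "\<not> overlap D C" if "C \<in> P" for C
  proof
    assume ovl: "overlap D C"
    then have "b \<notin> C" using least[OF that] unfolding overlap_def by blast
    moreover have "D - C \<in> P" using patchwork_Diff[OF patch D(1) that] ovl
      unfolding overlap_def by blast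
    ultimately have "D - C = D" using min D(2) by blast
    then show False using ovl unfolding overlap_def by blast
  qed
  then have "autonomous P D" using D unfolding autonomous_def by blast
  then show ?thesis using that D(2) least by blast
qed

lemma autonomous_subset_cohort:
  assumes "autonomous P D" "D \<subset> B"
  obtains A where "A \<in> cohort P B" "D \<subseteq> A"
proof -
  let ?\<A> = "{A. autonomous P A \<and> A \<subset> B \<and> D \<subseteq> A}"
  have "finite ?\<A>" by (rule finite_subset[OF _ fin]) (auto simp: autonomous_def)
  then obtain A where "A \<in> ?\<A>" "\<forall>C\<in>?\<A>. A \<subseteq> C \<longrightarrow> A = C"
    using finite_has_maximal[of ?\<A>] assms by blast
  then show ?thesis using that[of A] unfolding cohort_def by blast
qed

text \<open>Maximality of \<open>X\<close> keeps \<open>Z\<close> from being autonomous. A P-set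
  overlapping \<open>Z\<close> meets \<open>B\<close> without containing it, so autonomy of
  \<open>B\<close> forces it inside.\<close>

lemma mem_overlapping_inside:
  assumes "Z \<in> P" "Z \<subset> B" "X \<in> cohort P B" "X \<subset> Z"
  obtains C where "C \<in> P" "C \<subset> B" "overlap Z C"
proof -
  have "\<not> autonomous P Z" using assms unfolding cohort_def by blast
  then obtain C where C: "C \<in> P" "overlap Z C"
    using assms unfolding autonomous_def by blast
  then have "B \<inter> C \<noteq> {}" "\<not> B \<subseteq> C" using assms(2) unfolding overlap_def by blast+
  then show ?thesis using that C autonomous_cases[OF auto_B C(1)] by blast
qed

text \<open>It suffices to cover \<open>B\<close> by two P-sets strictly inside it. The least P-set
  around any point then lies in one of them, so it is a proper autonomous subset of \<open>B\<close>
  and is contained in a cohort member.\<close>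

lemma cohort_covers:
  assumes XY: "X \<in> cohort P B" "Y \<in> cohort P B" "X \<noteq> Y" "X \<union> Y \<in> P"
  shows "\<Union> (cohort P B) = B"
proof
  show "\<Union> (cohort P B) \<subseteq> B" using cohort_mem(4) by blast
  have "\<exists>Z C. Z \<in> P \<and> C \<in> P \<and> Z \<subset> B \<and> C \<subset> B \<and> Z \<union> C = B"
  proof (cases "X \<union> Y = B")
    case True
    then show ?thesis using XY cohort_mem(2,4) by blast
  next
    case False
    define \<Z> where "\<Z> = {Z \<in> P. X \<union> Y \<subseteq> Z \<and> Z \<subset> B}"
    have "X \<union> Y \<subseteq> B" using cohort_mem(4) XY(1,2) by blast
    then have "X \<union> Y \<in> \<Z>" using False XY(4) unfolding \<Z>_def by blast
    moreover have "finite \<Z>" using fin unfolding \<Z>_def by simp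
    ultimately obtain Z where "Z \<in> \<Z>" and max: "\<forall>Z'\<in>\<Z>. Z \<subseteq> Z' \<longrightarrow> Z = Z'"
      using finite_has_maximal[of \<Z>] by blast
    then have Z: "Z \<in> P" "X \<union> Y \<subseteq> Z" "Z \<subset> B" unfolding \<Z>_def by blast+
    have "X \<subset> Z" using Z(2) cohort_disjoint[OF XY(1-3)] cohort_mem(3)[OF XY(2)] by blast
    then obtain C where C: "C \<in> P" "C \<subset> B" "overlap Z C"
      using mem_overlapping_inside[OF Z(1,3) XY(1)] by blast
    then have "Z \<union> C \<in> P" using patchwork_Un[OF patch Z(1)] unfolding overlap_def by blast
    moreover have "\<not> C \<subseteq> Z" using C(3) unfolding overlap_def by blast
    \<comment> \<open>This P-set inside \<open>B\<close> is strictly larger than \<open>Z\<close>,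
      so by maximality of \<open>Z\<close> it cannot be a proper subset of \<open>B\<close>.\<close>
    ultimately have "Z \<union> C = B" using max Z C(2) unfolding \<Z>_def by blast
    then show ?thesis using Z C by blast
  qed
  then obtain Z C where ZC: "Z \<in> P" "C \<in> P" "Z \<subset> B" "C \<subset> B" "Z \<union> C = B" by blast
  show "B \<subseteq> \<Union> (cohort P B)"
  proof
    fix b assume "b \<in> B"
    then obtain D where D: "autonomous P D" "b \<in> D" "\<And>C. C \<in> P \<Longrightarrow> b \<in> C \<Longrightarrow> D \<subseteq> C"
      using autonomous_least_mem by blast
    have "D \<subset> B" using D(3)[of Z] D(3)[of C] ZC \<open>b \<in> B\<close> by blast
    then obtain A where "A \<in> cohort P B" "D \<subseteq> A" using autonomous_subset_cohort D(1) by blast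
    then show "b \<in> \<Union> (cohort P B)" using D(2) by blast
  qed
qed

section \<open>Collapsing the cohort members to points\<close>

definition quotient :: "'a set set set" where
  "quotient = {S. S \<subseteq> cohort P B \<and> \<Union> S \<in> P}"

text \<open>Distinct cohort members are disjoint and nonempty, so passing to unions respects
  overlap, intersection and difference. A nontrivial autonomous family would have its union strictly
  between a cohort member and \<open>B\<close>, hence overlapped by a P-set inside
  \<open>B\<close>.\<close>

lemma primitive_patchwork_quotient:
  assumes cover: "\<Union> (cohort P B) = B"
  shows "primitive_patchwork (cohort P B) quotient"
proof
  let ?M = "cohort P B"
  \<comment> \<open>A point determines the cohort member that contains it.\<close>
  have mem_Union: "A \<in> S" if "A \<in> ?M" "S \<subseteq> ?M" "x \<in> A" "x \<in> \<Union> S" for A S x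
    using that cohort_disjoint[of A] by blast
  have "overlap (\<Union> S) (\<Union> T) \<and> \<Union> (S \<inter> T) = \<Union> S \<inter> \<Union> T \<and> \<Union> (S - T) = \<Union> S - \<Union> T"
    if "S \<subseteq> ?M" "T \<subseteq> ?M" "overlap S T" for S T
  proof (intro conjI)
    have diff: "\<Union> (S - T) = \<Union> S - \<Union> T" if "S \<subseteq> ?M" "T \<subseteq> ?M" for S T
      using that mem_Union[of _ T] by blast
    then show "\<Union> (S - T) = \<Union> S - \<Union> T" using that by blast
    show inter: "\<Union> (S \<inter> T) = \<Union> S \<inter> \<Union> T" using that mem_Union[of _ T] by blast
    have ne: "\<Union> R \<noteq> {}" if "R \<subseteq> ?M" "R \<noteq> {}" for R using that cohort_mem(3) by blast
    have "\<Union> (S \<inter> T) \<noteq> {}" "\<Union> (S - T) \<noteq> {}" "\<Union> (T - S) \<noteq> {}"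
      by (rule ne; use that in \<open>auto simp: overlap_def\<close>)+
    then show "overlap (\<Union> S) (\<Union> T)"
      unfolding inter diff[OF that(1,2)] diff[OF that(2,1)] overlap_def by simp
  qed
  moreover have "{} \<in> quotient" "?M \<in> quotient"
    using patch auto_B cover unfolding quotient_def patchwork_def autonomous_def by auto
  ultimately show "patchwork ?M quotient"
    using patch unfolding patchwork_def quotient_def by auto
  show "finite ?M" by (rule finite_cohort)
  show "{v} \<in> quotient" if "v \<in> ?M" for v
    using that cohort_mem(2) unfolding quotient_def by simp
  show "S = ?M \<or> (\<exists>v. S = {v})" if S: "autonomous quotient S" for S
  proof (rule ccontr)
    assume neg: "\<not> (S = ?M \<or> (\<exists>v. S = {v}))"
    have S': "S \<subseteq> ?M" "\<Union> S \<in> P" "S \<noteq> {}" using S unfolding autonomous_def quotient_def by auto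
    obtain X where X: "X \<in> S" using S'(3) by blast
    obtain Y where Y: "Y \<in> S" "Y \<noteq> X" using neg X by blast
    obtain W where W: "W \<in> ?M" "W \<notin> S" using neg S'(1) by blast
    have "X \<subset> \<Union> S" using X Y S'(1) cohort_disjoint[of X Y] cohort_mem(3)[of Y] by blast
    moreover have "\<Union> S \<subset> B"
    proof -
      obtain w where "w \<in> W" using cohort_mem(3)[OF W(1)] by blast
      then have "w \<in> B" "w \<notin> \<Union> S" using W cohort_mem(4)[of W] mem_Union[OF W(1) S'(1)] by blast+
      then show ?thesis using S'(1) cover by blast
    qed
    ultimately obtain C where C: "C \<in> P" "C \<subset> B" "overlap (\<Union> S) C"
      using mem_overlapping_inside S' X by blast
    define T where "T = {A \<in> ?M. A \<inter> C \<noteq> {}}"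
    \<comment> \<open>Otherwise autonomy puts \<open>C\<close> inside \<open>A\<close>. Then
      \<open>A\<close> shares a point with the union of \<open>S\<close>, so \<open>A\<close>
      belongs to \<open>S\<close> and \<open>C\<close> lies in that union, against the
      overlap.\<close>
    have "A \<subseteq> C" if A: "A \<in> T" for A
    proof (rule ccontr)
      assume "\<not> A \<subseteq> C"
      then have "C \<subseteq> A" using autonomous_cases[of A C] cohort_mem(1) A C(1) unfolding T_def by blast
      moreover obtain x where "x \<in> \<Union> S" "x \<in> C" using C(3) unfolding overlap_def by blast
      ultimately have "A \<in> S" using mem_Union[of A S x] A S'(1) unfolding T_def by blast
      then show False using C(3) \<open>C \<subseteq> A\<close> unfolding overlap_def by blast
    qed
    then have "\<Union> T \<subseteq> C" by blast
    moreover have "C \<subseteq> \<Union> T"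
    proof
      fix c assume "c \<in> C"
      then have "c \<in> \<Union> ?M" using C(2) cover by blast
      then show "c \<in> \<Union> T" using \<open>c \<in> C\<close> unfolding T_def by blast
    qed
    ultimately have TC: "\<Union> T = C" by (rule subset_antisym)
    then have "T \<in> quotient" using C(1) unfolding quotient_def by (auto simp: T_def)
    moreover have "overlap S T"
    proof -
      obtain x where x: "x \<in> \<Union> S" "x \<in> \<Union> T" using C(3) TC unfolding overlap_def by blast
      then obtain A where "A \<in> T" "x \<in> A" by blast
      then have "A \<in> S" using mem_Union[OF _ S'(1) _ x(1)] unfolding T_def by blast
      moreover have "\<not> S \<subseteq> T" "\<not> T \<subseteq> S"
        using C(3) unfolding overlap_def TC[symmetric] by (meson Union_mono)+
      ultimately show ?thesis using \<open>A \<in> T\<close> unfolding overlap_def by blast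
    qed
    ultimately show False using S unfolding autonomous_def by blast
  qed
qed

section \<open>The adjacency graph of the cohort\<close>

lemma adjacent_iff_quotient:
  assumes "X \<in> cohort P B" "Y \<in> cohort P B" "X \<noteq> Y"
  shows "adjacent P X Y \<longleftrightarrow> {X, Y} \<in> quotient"
  using assms cohort_mem(2) cohort_disjoint unfolding adjacent_def quotient_def by simp

lemma adjacency_graph_edge_iff:
  assumes "X \<in> cohort P B" "Y \<in> cohort P B"
  shows "{X, Y} \<in> snd (adjacency_graph P (cohort P B)) \<longleftrightarrow> X \<noteq> Y \<and> {X, Y} \<in> quotient"
proof -
  have "{X, Y} \<in> snd (adjacency_graph P (cohort P B)) \<longleftrightarrow> X \<noteq> Y \<and> adjacent P X Y"
    using assms unfolding adjacency_graph_def adjacent_def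
    by (auto simp: doubleton_eq_iff Un_commute Int_commute)
  then show ?thesis using adjacent_iff_quotient assms by blast
qed

lemma cohort_complete_or_path:
  assumes XY: "X \<in> cohort P B" "Y \<in> cohort P B" "X \<noteq> Y" "adjacent P X Y"
  shows "\<Union> (cohort P B) = B \<and>
    (3 \<le> card (cohort P B) \<and>
       (\<forall>X\<in>cohort P B. \<forall>Y\<in>cohort P B. X \<noteq> Y \<longrightarrow> adjacent P X Y) \<or>
     2 \<le> card (cohort P B) \<and> path_graph (adjacency_graph P (cohort P B)))"
proof -
  let ?M = "cohort P B"
  have cover: "\<Union> ?M = B" using cohort_covers XY unfolding adjacent_def by blast
  interpret primitive_patchwork ?M quotient by (rule primitive_patchwork_quotient[OF cover])
  have "edge X Y" using XY adjacent_iff_quotient by blast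
  then obtain vs where vs: "successively edge vs" "distinct vs" "set vs = ?M" "2 \<le> length vs"
    using hamiltonian_path XY(3) by blast
  have card: "card ?M = length vs" using vs(2,3) distinct_card by metis
  \<comment> \<open>With a chord, the Hamiltonian path spans a complete graph on at least three
    vertices. Without one, its own edges are all the edges.\<close>
  show ?thesis
  proof (cases "\<exists>i j. edge (vs ! i) (vs ! j) \<and> j < length vs \<and> i + 2 \<le> j")
    case True
    then obtain i j where ij: "edge (vs ! i) (vs ! j)" "j < length vs" "i + 2 \<le> j" by blast
    then have "adjacent P X' Y'" if "X' \<in> ?M" "Y' \<in> ?M" "X' \<noteq> Y'" for X' Y'
      using chord_imp_complete[OF vs(1-3) ij that(1,2)] adjacent_iff_quotient that by blast
    moreover have "3 \<le> card ?M" using ij card by simp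
    ultimately show ?thesis using cover by blast
  next
    case False
    have "{vs ! i, vs ! j} \<in> snd (adjacency_graph P ?M) \<longleftrightarrow> \<bar>int i - int j\<bar> = 1"
      if ij: "i < length vs" "j < length vs" for i j
    proof -
      have consec: "edge (vs ! m) (vs ! Suc m)" if "Suc m < length vs" for m
        using vs(1) that by (simp add: successively_conv_nth)
      \<comment> \<open>The diagonal is excluded because \<open>edge\<close> has loops; the
        adjacency graph has none, which settles \<open>i = j\<close>.\<close>
      have "edge (vs ! i) (vs ! j) \<longleftrightarrow> \<bar>int i - int j\<bar> = 1" if "i \<noteq> j"
      proof
        assume e: "edge (vs ! i) (vs ! j)"
        then have "edge (vs ! j) (vs ! i)" by (simp add: insert_commute)
        then have "\<not> i + 2 \<le> j" "\<not> j + 2 \<le> i" using False e ij by blast+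
        then show "\<bar>int i - int j\<bar> = 1" using that by linarith
      next
        assume "\<bar>int i - int j\<bar> = 1"
        then have "j = Suc i \<or> i = Suc j" by linarith
        then show "edge (vs ! i) (vs ! j)" using consec ij by (metis insert_commute)
      qed
      moreover have "vs ! i \<in> ?M" "vs ! j \<in> ?M" using ij vs(3) nth_mem by blast+
      moreover have "vs ! i = vs ! j \<longleftrightarrow> i = j" using ij vs(2) by (simp add: nth_eq_iff_index_eq)
      ultimately show ?thesis using adjacency_graph_edge_iff by auto
    qed
    then have "path_graph (adjacency_graph P ?M)"
      using vs unfolding path_graph_def by (intro exI[of _ vs]) (simp add: adjacency_graph_def)
    then show ?thesis using vs(4) card cover by simp
  qed
qed

section \<open>Mutual exclusion of the alternatives\<close>

lemma path_graph_adjacent: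
  assumes "path_graph (adjacency_graph P (cohort P B))"
  obtains X Y where "X \<in> cohort P B" "Y \<in> cohort P B" "X \<noteq> Y" "adjacent P X Y"
proof -
  obtain vs where vs: "2 \<le> length vs" "set vs = cohort P B"
    and edges: "\<And>i j. i < length vs \<Longrightarrow> j < length vs \<Longrightarrow>
      {vs ! i, vs ! j} \<in> snd (adjacency_graph P (cohort P B)) \<longleftrightarrow> \<bar>int i - int j\<bar> = 1"
    using assms unfolding path_graph_def adjacency_graph_def by auto
  have len: "0 < length vs" "1 < length vs" using vs(1) by linarith+
  then have mem: "vs ! 0 \<in> cohort P B" "vs ! 1 \<in> cohort P B" using vs(2) nth_mem by blast+
  have "{vs ! 0, vs ! 1} \<in> snd (adjacency_graph P (cohort P B))"
    using edges[OF len] by simp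
  then have "vs ! 0 \<noteq> vs ! 1" "adjacent P (vs ! 0) (vs ! 1)"
    unfolding adjacency_graph_edge_iff[OF mem] using adjacent_iff_quotient[OF mem] by auto
  then show ?thesis by (rule that[OF mem])
qed

text \<open>The first and third vertices of the path serve. A path on two vertices is complete,
  which is why three members are required.\<close>

lemma path_graph_nonadjacent:
  assumes "path_graph (adjacency_graph P (cohort P B))" "3 \<le> card (cohort P B)"
  obtains X Y where "X \<in> cohort P B" "Y \<in> cohort P B" "X \<noteq> Y" "\<not> adjacent P X Y"
proof -
  obtain vs where vs: "distinct vs" "set vs = cohort P B"
    and edges: "\<And>i j. i < length vs \<Longrightarrow> j < length vs \<Longrightarrow>
      {vs ! i, vs ! j} \<in> snd (adjacency_graph P (cohort P B)) \<longleftrightarrow> \<bar>int i - int j\<bar> = 1"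
    using assms unfolding path_graph_def adjacency_graph_def by auto
  have "3 \<le> length vs" using assms(2) vs distinct_card by metis
  then have len: "0 < length vs" "2 < length vs" by linarith+
  then have mem: "vs ! 0 \<in> cohort P B" "vs ! 2 \<in> cohort P B" using vs(2) nth_mem by blast+
  have neq: "vs ! 0 \<noteq> vs ! 2" using nth_eq_iff_index_eq[OF vs(1) len] by simp
  have "{vs ! 0, vs ! 2} \<notin> snd (adjacency_graph P (cohort P B))" using edges[OF len] by simp
  then have "\<not> adjacent P (vs ! 0) (vs ! 2)"
    unfolding adjacency_graph_edge_iff[OF mem] using adjacent_iff_quotient[OF mem] neq by auto
  then show ?thesis by (rule that[OF mem neq])
qed

text \<open>The bound on the cardinality keeps the universal condition from holding
  vacuously.\<close>

lemma complete_adjacent: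
  assumes "3 \<le> card (cohort P B)"
    and "\<forall>X\<in>cohort P B. \<forall>Y\<in>cohort P B. X \<noteq> Y \<longrightarrow> adjacent P X Y"
  obtains X Y where "X \<in> cohort P B" "Y \<in> cohort P B" "X \<noteq> Y" "adjacent P X Y"
  using assms card_le_Suc0_iff_eq[OF finite_cohort]
  by (metis One_nat_def numeral_le_one_iff order_trans semiring_norm(70))

end

theorem theorem4p9:
  fixes \<Omega> :: "'a set" and P :: "'a set set" and B :: "'a set"
  assumes "patchwork \<Omega> P" and "finite P" and "autonomous P B"
  shows "exactly_one_of
    (card (cohort P B) \<ge> 3 \<and>
       (\<forall>X\<in>cohort P B. \<forall>Y\<in>cohort P B. X \<noteq> Y \<longrightarrow> adjacent P X Y) \<and>
       \<Union> (cohort P B) = B)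
    (card (cohort P B) \<ge> 2 \<and>
       path_graph (adjacency_graph P (cohort P B)) \<and>
       \<Union> (cohort P B) = B)
    (\<forall>X\<in>cohort P B. \<forall>Y\<in>cohort P B. X \<noteq> Y \<longrightarrow> \<not> adjacent P X Y)"
    (is "exactly_one_of ?complete ?path ?none")
proof -
  have "?none \<or> ?complete \<or> ?path"
    using cohort_complete_or_path[OF assms] by blast
  moreover have "\<not> (?complete \<and> ?path)"
    by (metis path_graph_nonadjacent[OF assms])
  moreover have "\<not> (?complete \<and> ?none)"
    by (metis complete_adjacent[OF assms])
  moreover have "\<not> (?path \<and> ?none)"
    by (metis path_graph_adjacent[OF assms])
  ultimately show ?thesis unfolding exactly_one_of_def by argo
qed

end
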